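(* Let $\mathcal H$ be a Hilbert space and let $\{f_k\}_{k\in\mathbb Z}=\{T^kf_0\}_{k\in\mathbb Z}$ be a frame for $\mathcal H$, where $T\in B(\mathcal H)$ is invertible. Assume that $\{g_k\}_{k\in\mathbb Z}=\{V^kg_0\}_{k\in\mathbb Z}$ is a dual frame of $\{f_k\}_{k\in\mathbb Z}$ and that $V$ is bounded. Then $V=(T^* )^{-1}$.
   Context: A sequence $\{f_k\}_{k\in\mathbb Z}$ is a frame for $\mathcal H$ if there are $A,B>0$ with $A\|f\|^2\le\sum_{k}|\langle f,f_k\rangle|^2\le B\|f\|^2$ for all $f\in\mathcal H$. A dual frame of $\{f_k\}_{k\in\mathbb Z}$ is a frame $\{g_k\}_{k\in\mathbb Z}$ for $\mathcal H$ with $f=\sum_{k\in\mathbb Z}\langle f,g_k\rangle f_k$ for all $f\in\mathcal H$. $\{f_k\}=\{T^kf_0\}$ means $f_k=T^kf_0$ for all $k\in\mathbb Z$. $\{g_k\}=\{V^kg_0\}$ means that $V$ is a linear operator mapping $\operatorname{span}\{g_k\}_{k\in\mathbb Z}$ (finite linear combinations) bijectively onto itself with $g_k=V^kg_0$ for all $k\in\mathbb Z$, where $V^k:=(V^{-1})^{-k}$ for $k<0$ with the inverse taken on this span; a bounded such $V$ is identified with its unique bounded extension to $\mathcal H$ (whose invertibility is not assumed). *)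

theory Defs
  imports "HOL-Analysis.Analysis"
begin

text \<open>
  Scalars: the complete real normed fields with a conjugation. The norm of a
  \<^class>\<open>real_normed_field\<close> is multiplicative, so by the Gelfand-Mazur theorem the only
  models are the real and the complex numbers.
\<close>

class inner_scalar = real_normed_field + complete_space +
  fixes conjugate :: "'a \<Rightarrow> 'a"
  assumes conjugate_add: "conjugate (x + y) = conjugate x + conjugate y"
    and conjugate_mult: "conjugate (x * y) = conjugate x * conjugate y"
    and conjugate_conjugate: "conjugate (conjugate x) = x"
    and mult_conjugate: "x * conjugate x = (norm x)\<^sup>2 *\<^sub>R 1"

instantiation real :: inner_scalar
begin
definition conjugate_real :: "real \<Rightarrow> real" where "conjugate_real x = x"
instance
  by standard (auto simp: conjugate_real_def power2_eq_square)
end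

instantiation complex :: inner_scalar
begin
definition conjugate_complex :: "complex \<Rightarrow> complex" where "conjugate_complex x = cnj x"
instance
  by standard (simp_all add: conjugate_complex_def complex_norm_square[symmetric] scaleR_conv_of_real)
end

text \<open>
  A real or complex Hilbert space: a Banach space whose norm comes from an inner product,
  linear in the first argument.
\<close>

locale hilbert_space = vector_space smul
  for smul :: "'k::inner_scalar \<Rightarrow> 'a::banach \<Rightarrow> 'a" +
  fixes ip :: "'a \<Rightarrow> 'a \<Rightarrow> 'k"
  assumes scale_of_real: "smul (of_real r) x = r *\<^sub>R x"
    and ip_add_left: "ip (x + y) z = ip x z + ip y z"
    and ip_scale_left: "ip (smul c x) z = c * ip x z"
    and ip_commute: "ip y x = conjugate (ip x y)"
    and ip_self: "ip x x = of_real ((norm x)\<^sup>2)"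

lemma hilbert_space_real:
  "hilbert_space scaleR ((\<bullet>) :: 'a::{real_inner,banach} \<Rightarrow> 'a \<Rightarrow> real)"
  by unfold_locales
    (simp_all add: scaleR_add_right scaleR_add_left inner_add_right conjugate_real_def
      inner_commute power2_norm_eq_inner)

lemma hilbert_space_complex:
  "hilbert_space (*) (\<lambda>x y :: complex. x * cnj y)"
  by unfold_locales
    (simp_all add: distrib_left distrib_right mult.assoc conjugate_complex_def
      complex_norm_square[symmetric] scaleR_conv_of_real mult.commute)

definition frame :: "('a \<Rightarrow> 'a::real_normed_vector \<Rightarrow> 'k::real_normed_field) \<Rightarrow> (int \<Rightarrow> 'a) \<Rightarrow> bool"
  where "frame ip F \<longleftrightarrow> (\<exists>A>0. \<exists>B>0. \<forall>x.
    (\<lambda>k. (norm (ip x (F k)))\<^sup>2) summable_on UNIV \<and>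
    A * (norm x)\<^sup>2 \<le> (\<Sum>\<^sub>\<infinity>k. (norm (ip x (F k)))\<^sup>2) \<and>
    (\<Sum>\<^sub>\<infinity>k. (norm (ip x (F k)))\<^sup>2) \<le> B * (norm x)\<^sup>2)"

definition dual_frame ::
  "('k \<Rightarrow> 'a \<Rightarrow> 'a) \<Rightarrow> ('a \<Rightarrow> 'a::real_normed_vector \<Rightarrow> 'k::real_normed_field) \<Rightarrow>
    (int \<Rightarrow> 'a) \<Rightarrow> (int \<Rightarrow> 'a) \<Rightarrow> bool"
  where "dual_frame smul ip F G \<longleftrightarrow>
    frame ip G \<and> (\<forall>x. ((\<lambda>k. smul (ip x (G k)) (F k)) has_sum x) UNIV)"

definition linear_op_on :: "('k \<Rightarrow> 'a \<Rightarrow> 'a) \<Rightarrow> 'a set \<Rightarrow> ('a::ab_group_add \<Rightarrow> 'a) \<Rightarrow> bool"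
  where "linear_op_on smul S L \<longleftrightarrow>
    (\<forall>x\<in>S. \<forall>y\<in>S. L (x + y) = L x + L y) \<and> (\<forall>c. \<forall>x\<in>S. L (smul c x) = smul c (L x))"

definition bounded_op_on :: "'a set \<Rightarrow> ('a::real_normed_vector \<Rightarrow> 'a) \<Rightarrow> bool"
  where "bounded_op_on S L \<longleftrightarrow> (\<exists>K. \<forall>x\<in>S. norm (L x) \<le> K * norm x)"

text \<open>Membership in $B(H)$, and invertibility in the algebra $B(H)$.\<close>

definition bounded_op :: "('k \<Rightarrow> 'a \<Rightarrow> 'a) \<Rightarrow> ('a::real_normed_vector \<Rightarrow> 'a) \<Rightarrow> bool"
  where "bounded_op smul L \<longleftrightarrow> linear_op_on smul UNIV L \<and> bounded_op_on UNIV L"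

definition invertible_op :: "('k \<Rightarrow> 'a \<Rightarrow> 'a) \<Rightarrow> ('a::real_normed_vector \<Rightarrow> 'a) \<Rightarrow> bool"
  where "invertible_op smul L \<longleftrightarrow>
    bounded_op smul L \<and> (\<exists>M. bounded_op smul M \<and> L \<circ> M = id \<and> M \<circ> L = id)"

text \<open>The Hilbert space adjoint; on bounded operators it exists uniquely by Riesz representation.\<close>

definition hilbert_adjoint :: "('a \<Rightarrow> 'a \<Rightarrow> 'k) \<Rightarrow> ('a \<Rightarrow> 'a) \<Rightarrow> 'a \<Rightarrow> 'a"
  where "hilbert_adjoint ip L = (THE M. \<forall>x y. ip (L x) y = ip x (M y))"

text \<open>Integer powers of a map that is a bijection of the set \<open>S\<close>, with the inverse taken on \<open>S\<close>.\<close>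

definition int_power_on :: "'a set \<Rightarrow> ('a \<Rightarrow> 'a) \<Rightarrow> int \<Rightarrow> 'a \<Rightarrow> 'a"
  where "int_power_on S L k =
    (if k \<ge> 0 then L ^^ nat k else inv_into S L ^^ nat (- k))"

text \<open>
  \<open>g k = V\<^sup>k (g 0)\<close> for a linear bijection \<open>V\<close> of the algebraic span of the \<open>g k\<close>.
  The values of \<open>V\<close> outside that span are irrelevant.
\<close>

definition represents ::
  "('k::field \<Rightarrow> 'a \<Rightarrow> 'a) \<Rightarrow> ('a::ab_group_add \<Rightarrow> 'a) \<Rightarrow> (int \<Rightarrow> 'a) \<Rightarrow> bool"
  where "represents smul V g \<longleftrightarrow>
    (let S = module.span smul (range g) in
      linear_op_on smul S V \<and> bij_betw V S S \<and> (\<forall>k. g k = int_power_on S V k (g 0)))"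

text \<open>
  The bounded extension to the whole space of an operator that is linear and bounded on the
  subspace \<open>S\<close>; it exists uniquely whenever \<open>S\<close> is dense.
\<close>

definition bounded_extension ::
  "('k \<Rightarrow> 'a \<Rightarrow> 'a) \<Rightarrow> 'a set \<Rightarrow> ('a::real_normed_vector \<Rightarrow> 'a) \<Rightarrow> 'a \<Rightarrow> 'a"
  where "bounded_extension smul S V = (THE W. bounded_op smul W \<and> (\<forall>x\<in>S. W x = V x))"

end

theory Submission
  imports Defs
begin

text \<open>
  Expanding \<open>x\<close> in the frame gives \<open>T\<^sup>* y = \<Sum>\<^sub>k \<langle>y, f\<^sub>k\<^sub>+\<^sub>1\<rangle> g\<^sub>k\<close> and
  \<open>(T\<^sup>-\<^sup>1)\<^sup>* y = \<Sum>\<^sub>k \<langle>y, f\<^sub>k\<^sub>-\<^sub>1\<rangle> g\<^sub>k\<close>, so the adjoints come from explicit series and neither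
  Riesz representation nor the projection theorem is needed. Likewise
  \<open>y = \<Sum>\<^sub>k \<langle>y, f\<^sub>k\<rangle> g\<^sub>k\<close>, hence the span of the \<open>g\<^sub>k\<close> is dense; applying the bounded
  operator \<open>V\<close> termwise for \<open>y\<close> in the span yields \<open>V y = \<Sum>\<^sub>k \<langle>y, f\<^sub>k\<rangle> g\<^sub>k\<^sub>+\<^sub>1 = (T\<^sup>-\<^sup>1)\<^sup>* y\<close>.
\<close>

section \<open>Integer powers of a bijection and two-sided orbits\<close>

lemma int_power_on_succ:
  assumes "bij_betw L S S" "x \<in> S"
  shows "int_power_on S L (k + 1) x = L (int_power_on S L k x)"
proof (cases "k \<ge> 0")
  case True
  then show ?thesis by (simp add: int_power_on_def nat_add_distrib)
next
  case False
  define n where "n = nat (- (k + 1))"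
  have k: "nat (- k) = Suc n" and L: "L ` S = S"
    using False assms(1) by (auto simp: n_def bij_betw_def)
  \<comment> \<open>\<open>inv_into S L\<close> is a right inverse of \<open>L\<close> only on
    \<open>S\<close>, so its iterates must first be kept there before \<open>L\<close> can cancel
    one factor.\<close>
  have "(inv_into S L ^^ n) x \<in> S"
    by (induction n) (use assms(2) L in \<open>auto intro: inv_into_into\<close>)
  then have "L (inv_into S L ((inv_into S L ^^ n) x)) = (inv_into S L ^^ n) x"
    by (simp add: f_inv_into_f L)
  \<comment> \<open>At \<open>k = -1\<close> the exponent \<open>k + 1\<close> falls into the
    forward branch of the definition; both branches give the zeroth power.\<close>
  moreover have "int_power_on S L (k + 1) x = (inv_into S L ^^ n) x"
    using False by (cases "k = -1") (auto simp: int_power_on_def n_def)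
  ultimately show ?thesis
    using False k by (simp add: int_power_on_def)
qed

text \<open>Turns the description by powers into a one-step shift, at negative indices too. It
  serves \<open>T\<close> with \<open>UNIV\<close> and \<open>V\<close> with the span of the
  \<open>g k\<close>.\<close>

lemma int_power_on_orbit:
  assumes "bij_betw L S S" "h 0 \<in> S" "\<forall>k. h k = int_power_on S L k (h 0)"
  shows "L (h k) = h (k + 1)"
  using assms(3) int_power_on_succ[OF assms(1,2), of k] by metis

section \<open>Norm of the conjugate and unconditional summation\<close>

lemma norm_conjugate [simp]: "norm (conjugate x) = norm (x :: 'k::inner_scalar)"
proof (cases "x = 0")
  case True
  have "conjugate 0 = (0 :: 'k)"
    using conjugate_add[of 0 "0 :: 'k"] by simp
  with True show ?thesis by simp
next
  case False
  have "norm x * norm (conjugate x) = (norm x)\<^sup>2"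
    using arg_cong[OF mult_conjugate[of x], of norm] by (simp add: norm_mult)
  with False show ?thesis by (simp add: power2_eq_square)
qed

text \<open>Frame series need not converge absolutely, so convergence is drawn from completeness:
  small sums off \<open>F0\<close> make the net of finite partial sums Cauchy.\<close>

lemma summable_on_CauchyI:
  fixes u :: "'b \<Rightarrow> 'c::banach"
  assumes "\<And>e. e > 0 \<Longrightarrow> \<exists>F0. finite F0 \<and> F0 \<subseteq> A \<and>
    (\<forall>F. finite F \<and> F \<subseteq> A \<and> F \<inter> F0 = {} \<longrightarrow> norm (sum u F) < e)"
  shows "u summable_on A"
proof -
  have "\<exists>P. eventually P (finite_subsets_at_top A) \<and>
      (\<forall>F F'. P F \<and> P F' \<longrightarrow> dist (sum u F) (sum u F') < e)" if "e > 0" for e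
  proof -
    obtain F0 where F0: "finite F0" "F0 \<subseteq> A"
      "\<And>F. finite F \<Longrightarrow> F \<subseteq> A \<Longrightarrow> F \<inter> F0 = {} \<Longrightarrow> norm (sum u F) < e / 2"
      using assms[OF half_gt_zero[OF \<open>e > 0\<close>]] by metis
    define P where "P F \<longleftrightarrow> finite F \<and> F0 \<subseteq> F \<and> F \<subseteq> A" for F
    have "eventually P (finite_subsets_at_top A)"
      unfolding eventually_finite_subsets_at_top P_def using F0(1,2) by blast
    moreover have tail: "dist (sum u F) (sum u F0) < e / 2" if "P F" for F
    proof -
      have "norm (sum u (F - F0)) < e / 2"
        by (rule F0(3)) (use that in \<open>auto simp: P_def\<close>)
      then show ?thesis
        using that by (simp add: P_def dist_norm sum_diff)
    qed
    have "dist (sum u F) (sum u F') < e" if "P F" "P F'" for F F'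
      using dist_triangle_half_l[OF tail tail] that by blast
    ultimately show ?thesis by blast
  qed
  then have "cauchy_filter (filtermap (sum u) (finite_subsets_at_top A))"
    by (simp add: cauchy_filter_metric_filtermap)
  moreover have "complete (UNIV :: 'c set)"
    by (meson Cauchy_convergent UNIV_I complete_def convergent_def)
  ultimately obtain L where "(sum u \<longlongrightarrow> L) (finite_subsets_at_top A)"
    using complete_uniform[where S = "UNIV :: 'c set"] by (force simp: filterlim_def)
  then show ?thesis
    by (auto simp: summable_on_def has_sum_def)
qed

text \<open>Once \<open>F0\<close> catches the total up to \<open>e / 2\<close>, nonnegativity keeps
  the sum over \<open>F \<union> F0\<close> below the total, which leaves at most
  \<open>e / 2\<close> for \<open>F\<close>.\<close>

lemma summable_on_tail_less:
  fixes a :: "'b \<Rightarrow> real"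
  assumes "a summable_on A" "\<And>k. k \<in> A \<Longrightarrow> a k \<ge> 0" "e > 0"
  obtains F0 where "finite F0" "F0 \<subseteq> A"
    "\<And>F. finite F \<Longrightarrow> F \<subseteq> A \<Longrightarrow> F \<inter> F0 = {} \<Longrightarrow> sum a F < e"
proof -
  obtain F0 where F0: "finite F0" "F0 \<subseteq> A" "dist (sum a F0) (infsum a A) \<le> e / 2"
    using infsum_finite_approximation[OF assms(1), of "e / 2"] assms(3) by auto
  have "sum a F < e" if "finite F" "F \<subseteq> A" "F \<inter> F0 = {}" for F
  proof -
    have "sum a (F \<union> F0) \<le> infsum a A"
      using that F0(1,2) assms(1,2) by (intro finite_sum_le_infsum) auto
    then have "sum a F + sum a F0 \<le> infsum a A"
      using that F0(1) by (simp add: sum.union_disjoint)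
    then show ?thesis
      using F0(3) assms(3) by (simp add: dist_real_def abs_if split: if_splits)
  qed
  with F0 show thesis
    using that by blast
qed

text \<open>Meant for \<open>V\<close>, which is controlled only on the span. Since the partial sums
  and the limit all lie in \<open>S\<close>, so do their differences, and the bound \<open>K\<close>
  applies to these.\<close>

lemma has_sum_bounded_op_on:
  assumes "linear_op_on smul S L" "bounded_op_on S L"
    and S: "0 \<in> S" "\<And>x y. x \<in> S \<Longrightarrow> y \<in> S \<Longrightarrow> x + y \<in> S" "\<And>x y. x \<in> S \<Longrightarrow> y \<in> S \<Longrightarrow> x - y \<in> S"
    and "\<And>k. k \<in> A \<Longrightarrow> u k \<in> S" "y \<in> S" "(u has_sum y) A"
  shows "((\<lambda>k. L (u k)) has_sum L y) A"
proof -
  obtain K where K: "\<And>x. x \<in> S \<Longrightarrow> norm (L x) \<le> K * norm x"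
    using assms(2) by (auto simp: bounded_op_on_def)
  have add: "L (x + z) = L x + L z" if "x \<in> S" "z \<in> S" for x z
    using assms(1) that by (auto simp: linear_op_on_def)
  have diff: "L (x - z) = L x - L z" if "x \<in> S" "z \<in> S" for x z
    using add[of "x - z" z] S(3) that by simp
  have zero: "L 0 = 0" using diff[of 0 0] S(1) by simp
  have sum: "sum u F \<in> S \<and> L (sum u F) = (\<Sum>k\<in>F. L (u k))" if "finite F" "F \<subseteq> A" for F
    using that by induction (use S assms(6) zero add in auto)
  have lim: "((\<lambda>F. sum u F - y) \<longlongrightarrow> 0) (finite_subsets_at_top A)"
    using assms(8) by (simp add: has_sum_def LIM_zero)
  have "((\<lambda>F. (\<Sum>k\<in>F. L (u k)) - L y) \<longlongrightarrow> 0) (finite_subsets_at_top A)"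
  proof (rule Lim_null_comparison)
    have "norm ((\<Sum>k\<in>F. L (u k)) - L y) \<le> K * norm (sum u F - y)" if "finite F" "F \<subseteq> A" for F
      using K[of "sum u F - y"] sum[OF that] diff[of "sum u F" y] S(3) assms(7) by simp
    then show "\<forall>\<^sub>F F in finite_subsets_at_top A.
        norm ((\<Sum>k\<in>F. L (u k)) - L y) \<le> K * norm (sum u F - y)"
      by (intro eventually_finite_subsets_at_top_weakI)
    show "((\<lambda>F. K * norm (sum u F - y)) \<longlongrightarrow> 0) (finite_subsets_at_top A)"
      using tendsto_mult_right_zero[OF tendsto_norm_zero[OF lim]] .
  qed
  then show ?thesis
    unfolding has_sum_def by (rule LIM_zero_cancel)
qed

section \<open>Inner product calculus over the abstract scalars\<close>

context hilbert_space
begin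

lemma conjugate_zero [simp]: "conjugate 0 = (0 :: 'k)"
  by (metis norm_conjugate norm_eq_zero)

text \<open>That conjugation fixes the reals is not an axiom of the class; it follows by cancelling
  \<open>r\<close> in \<open>mult_conjugate\<close>.\<close>

lemma conjugate_of_real [simp]: "conjugate (of_real r) = (of_real r :: 'k)"
proof (cases "r = 0")
  case False
  have "of_real r * conjugate (of_real r) = (of_real r * of_real r :: 'k)"
    by (simp add: mult_conjugate power2_eq_square scaleR_conv_of_real)
  with False show ?thesis by simp
qed simp

lemma ip_add_right: "ip x (y + z) = ip x y + ip x z"
  by (metis ip_add_left ip_commute conjugate_add)

lemma ip_scale_right: "ip x (smul c y) = conjugate c * ip x y"
  by (metis ip_scale_left ip_commute conjugate_mult)

lemma norm_ip_commute: "norm (ip y x) = norm (ip x y)"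
  by (metis ip_commute norm_conjugate)

lemma ip_zero_left [simp]: "ip 0 x = 0"
  using ip_add_left[of 0 0 x] by simp

lemma ip_zero_right [simp]: "ip x 0 = 0"
  using ip_add_right[of x 0 0] by simp

lemma ip_diff_left: "ip (x - y) z = ip x z - ip y z"
  using ip_add_left[of "x - y" y z] by simp

lemma ip_sum_left: "ip (sum u F) x = (\<Sum>k\<in>F. ip (u k) x)"
  by (induction F rule: infinite_finite_induct) (auto simp: ip_add_left)

lemma ip_diff_right: "ip x (y - z) = ip x y - ip x z"
  using ip_add_right[of x "y - z" z] by simp

lemma ip_eqI:
  assumes "\<And>x. ip x y = ip x z"
  shows "y = z"
proof -
  have "ip (y - z) (y - z) = 0"
    by (simp add: ip_diff_right assms)
  then show ?thesis
    by (simp add: ip_self norm_power)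
qed

text \<open>\<open>scale_of_real\<close> gives homogeneity for real scalars; for general
  \<open>c\<close> it is read off from <c x, c x> = |c|^2 <x, x>.\<close>

lemma norm_smul: "norm (smul c x) = norm c * norm x"
proof -
  have "of_real ((norm (smul c x))\<^sup>2) = ip (smul c x) (smul c x)"
    by (rule ip_self[symmetric])
  also have "\<dots> = (c * conjugate c) * ip x x"
    by (simp add: ip_scale_left ip_scale_right mult_ac)
  also have "\<dots> = of_real ((norm c * norm x)\<^sup>2)"
    by (simp add: mult_conjugate ip_self scaleR_conv_of_real power_mult_distrib)
  finally have "of_real ((norm (smul c x))\<^sup>2) = (of_real ((norm c * norm x)\<^sup>2) :: 'k)" .
  then have "(norm (smul c x))\<^sup>2 = (norm c * norm x)\<^sup>2"
    by (simp only: of_real_eq_iff)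
  then show ?thesis
    by simp
qed

lemma norm_ip_le: "norm (ip x y) \<le> norm x * norm y"
proof (cases "y = 0")
  case True
  then show ?thesis
    by simp
next
  case False
  \<comment> \<open>\<open>smul c y\<close> is the orthogonal projection of \<open>x\<close> onto
    the line through \<open>y\<close>; by Pythagoras it is no longer than \<open>x\<close>.\<close>
  define c where "c = ip x y / of_real ((norm y)\<^sup>2)"
  define z where "z = x - smul c y"
  have zy: "ip z y = 0"
    using False by (simp add: z_def c_def ip_diff_left ip_scale_left ip_self)
  then have yz: "ip y z = 0"
    using ip_commute[of y z] by simp
  have x: "x = z + smul c y"
    by (simp add: z_def)
  have "ip x x = ip z z + ip (smul c y) (smul c y)"
    by (subst (1 2) x) (simp add: ip_add_left ip_add_right ip_scale_left ip_scale_right zy yz)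
  then have "of_real ((norm x)\<^sup>2) = (of_real ((norm z)\<^sup>2 + (norm (smul c y))\<^sup>2) :: 'k)"
    by (simp only: ip_self of_real_add)
  then have "(norm x)\<^sup>2 = (norm z)\<^sup>2 + (norm (smul c y))\<^sup>2"
    by (simp only: of_real_eq_iff)
  then have "(norm (smul c y))\<^sup>2 \<le> (norm x)\<^sup>2"
    by simp
  then have "norm c * norm y \<le> norm x"
    unfolding norm_smul by (rule power2_le_imp_le) simp
  moreover have "norm c = norm (ip x y) / (norm y)\<^sup>2"
    by (simp add: c_def norm_divide norm_power)
  ultimately show ?thesis
    using False by (simp add: field_simps power2_eq_square)
qed

lemma bounded_linear_ip_left: "bounded_linear (\<lambda>x. ip x y)"
proof (rule bounded_linear_intro)
  show "ip (r *\<^sub>R x) y = r *\<^sub>R ip x y" for r x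
    by (simp only: scale_of_real[symmetric] ip_scale_left scaleR_conv_of_real)
qed (rule ip_add_left norm_ip_le)+

lemma bounded_linear_ip_right: "bounded_linear (\<lambda>y. ip x y)"
proof (rule bounded_linear_intro)
  show "ip x (r *\<^sub>R y) = r *\<^sub>R ip x y" for r y
    by (simp only: scale_of_real[symmetric] ip_scale_right conjugate_of_real scaleR_conv_of_real)
  show "norm (ip x y) \<le> norm y * norm x" for y
    using norm_ip_le[of x y] by (simp add: mult.commute)
qed (auto simp: ip_add_right)

text \<open>\<open>bounded_linear\<close> refers to real scaling, which \<open>scale_of_real\<close>
  embeds in \<open>smul\<close>. Real linearity suffices for continuity and for moving an operator
  inside a sum.\<close>

lemma bounded_op_bounded_linear:
  assumes "bounded_op smul L"
  shows "bounded_linear L"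
proof -
  obtain K where K: "\<And>x. norm (L x) \<le> K * norm x"
    using assms by (auto simp: bounded_op_def bounded_op_on_def)
  show ?thesis
  proof (rule bounded_linear_intro)
    show "L (r *\<^sub>R x) = r *\<^sub>R L x" for r x
      using assms by (simp add: scale_of_real[symmetric] bounded_op_def linear_op_on_def)
    show "norm (L x) \<le> norm x * K" for x
      using K[of x] by (simp add: mult.commute)
  qed (use assms in \<open>simp add: bounded_op_def linear_op_on_def\<close>)
qed

section \<open>Bessel bounds and convergence of synthesis series\<close>

lemma bessel_sum_norm_le:
  assumes "finite F" "0 \<le> B" "\<And>x. (\<Sum>k\<in>F. (norm (ip x (g k)))\<^sup>2) \<le> B * (norm x)\<^sup>2"
  shows "(norm (\<Sum>k\<in>F. smul (c k) (g k)))\<^sup>2 \<le> B * (\<Sum>k\<in>F. (norm (c k))\<^sup>2)"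
proof -
  define y where "y = (\<Sum>k\<in>F. smul (c k) (g k))"
  define C where "C = (\<Sum>k\<in>F. (norm (c k))\<^sup>2)"
  have C: "0 \<le> C" by (simp add: C_def sum_nonneg)
  \<comment> \<open>Duality: pairing the sum with itself and using Cauchy-Schwarz for finite sums
    brings in the Bessel bound at \<open>y\<close>. One factor ||y|| then cancels.\<close>
  have "(norm y)\<^sup>2 = norm (ip y y)"
    by (simp add: ip_self norm_power)
  also have "\<dots> = norm (\<Sum>k\<in>F. c k * ip (g k) y)"
    by (subst (1) y_def) (simp add: ip_sum_left ip_scale_left)
  also have "\<dots> \<le> (\<Sum>k\<in>F. norm (c k) * norm (ip y (g k)))"
    by (rule sum_norm_le) (simp add: norm_mult norm_ip_commute)
  also have "\<dots> \<le> L2_set (\<lambda>k. norm (c k)) F * L2_set (\<lambda>k. norm (ip y (g k))) F"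
    using L2_set_mult_ineq[of "\<lambda>k. norm (c k)" "\<lambda>k. norm (ip y (g k))" F] by simp
  also have "\<dots> \<le> sqrt C * sqrt (B * (norm y)\<^sup>2)"
    unfolding L2_set_def C_def[symmetric]
    by (intro mult_left_mono real_sqrt_le_mono assms(3)) (use C in simp)
  also have "\<dots> = sqrt (B * C) * norm y"
    by (simp add: real_sqrt_mult)
  finally have "norm y * norm y \<le> sqrt (B * C) * norm y"
    by (simp add: power2_eq_square)
  then have "norm y \<le> sqrt (B * C)"
    using C assms(2) by (cases "y = 0") auto
  then have "(norm y)\<^sup>2 \<le> (sqrt (B * C))\<^sup>2"
    by (intro power_mono) auto
  then show ?thesis
    using C assms(2) by (simp add: y_def C_def)
qed

lemma frame_sum_norm_le:
  assumes "frame ip g"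
  obtains B where "B > 0"
    "\<And>F c. finite F \<Longrightarrow> (norm (\<Sum>k\<in>F. smul (c k) (g k)))\<^sup>2 \<le> B * (\<Sum>k\<in>F. (norm (c k))\<^sup>2)"
proof -
  obtain B where B: "B > 0" "\<And>x. (\<lambda>k. (norm (ip x (g k)))\<^sup>2) summable_on UNIV"
      "\<And>x. (\<Sum>\<^sub>\<infinity>k. (norm (ip x (g k)))\<^sup>2) \<le> B * (norm x)\<^sup>2"
    using assms by (auto simp: frame_def)
  have "(\<Sum>k\<in>F. (norm (ip x (g k)))\<^sup>2) \<le> B * (norm x)\<^sup>2" if "finite F" for F x
    by (rule order_trans[OF finite_sum_le_infsum B(3)]) (use that B(2) in auto)
  with B(1) show thesis
    by (intro that[of B] bessel_sum_norm_le) auto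
qed

lemma frame_synthesis_summable:
  assumes "frame ip g" "(\<lambda>k. (norm (c k))\<^sup>2) summable_on UNIV"
  shows "(\<lambda>k. smul (c k) (g k)) summable_on UNIV"
proof -
  obtain B where B: "B > 0"
    "\<And>F c. finite F \<Longrightarrow> (norm (\<Sum>k\<in>F. smul (c k) (g k)))\<^sup>2 \<le> B * (\<Sum>k\<in>F. (norm (c k))\<^sup>2)"
    using frame_sum_norm_le[OF assms(1)] by blast
  show ?thesis
  proof (rule summable_on_CauchyI)
    fix e :: real
    assume e: "e > 0"
    \<comment> \<open>A coefficient tail below e^2 / B gives a series tail of squared norm below
      e^2.\<close>
    then have "e\<^sup>2 / B > 0"
      using B(1) by simp
    then obtain F0 where F0: "finite F0"
      "\<And>F. finite F \<Longrightarrow> F \<inter> F0 = {} \<Longrightarrow> (\<Sum>k\<in>F. (norm (c k))\<^sup>2) < e\<^sup>2 / B"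
      using summable_on_tail_less[OF assms(2)] by (metis subset_UNIV zero_le_power2)
    have "norm (\<Sum>k\<in>F. smul (c k) (g k)) < e" if "finite F" "F \<inter> F0 = {}" for F
    proof (rule power2_less_imp_less)
      show "(norm (\<Sum>k\<in>F. smul (c k) (g k)))\<^sup>2 < e\<^sup>2"
        using B(2)[OF that(1), of c] F0(2)[OF that] B(1) by (simp add: field_simps)
    qed (use e in simp)
    with F0(1) show "\<exists>F0. finite F0 \<and> F0 \<subseteq> UNIV \<and> (\<forall>F. finite F \<and> F \<subseteq> UNIV \<and> F \<inter> F0 = {} \<longrightarrow>
        norm (\<Sum>k\<in>F. smul (c k) (g k)) < e)"
      by blast
  qed
qed

section \<open>Adjoints, dual expansions and bounded extensions\<close>

lemma hilbert_adjoint_eqI: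
  assumes "\<And>x y. ip (L x) y = ip x (M y)"
  shows "hilbert_adjoint ip L = M"
  unfolding hilbert_adjoint_def
proof (rule the_equality)
  show "\<forall>x y. ip (L x) y = ip x (M y)"
    using assms by blast
  show "N = M" if "\<forall>x y. ip (L x) y = ip x (N y)" for N
    using that assms by (intro ext ip_eqI) metis
qed

text \<open>Testing against all \<open>x\<close> gives linearity. Testing against \<open>M y\<close>
  gives ||M y||^2 = <L (M y), y> <= K ||M y|| ||y||, so \<open>M\<close> inherits the bound
  \<open>K\<close>.\<close>

lemma adjoint_bounded_op:
  assumes L: "bounded_op smul L" and adj: "\<And>x y. ip (L x) y = ip x (M y)"
  shows "bounded_op smul M"
proof -
  obtain K where K: "\<And>x. norm (L x) \<le> K * norm x"
    using L by (auto simp: bounded_op_def bounded_op_on_def)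
  have "M (x + y) = M x + M y" "M (smul c x) = smul c (M x)" for x y c
    by (rule ip_eqI, simp add: ip_add_right ip_scale_right adj[symmetric])+
  moreover have "norm (M y) \<le> K * norm y" for y
  proof -
    have "(norm (M y))\<^sup>2 = norm (ip (L (M y)) y)"
      by (simp add: adj ip_self norm_power)
    also have "\<dots> \<le> norm (L (M y)) * norm y"
      by (rule norm_ip_le)
    also have "\<dots> \<le> K * norm (M y) * norm y"
      by (intro mult_right_mono K) auto
    finally have "norm (M y) * norm (M y) \<le> norm (M y) * (K * norm y)"
      by (simp add: power2_eq_square mult_ac)
    \<comment> \<open>The sign of \<open>K\<close> is not assumed; this settles the case
      \<open>M y = 0\<close>, where nothing can be cancelled.\<close>
    moreover have "0 \<le> K * norm y"
      using K[of y] norm_ge_zero order_trans by blast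
    ultimately show ?thesis
      by (cases "M y = 0") auto
  qed
  ultimately show ?thesis
    by (auto simp: bounded_op_def linear_op_on_def bounded_op_on_def)
qed

text \<open>Expanding \<open>x\<close> in the \<open>f k\<close>, applying \<open>L\<close> and
  pairing with \<open>y\<close> agrees term by term with pairing \<open>x\<close> with the series
  for \<open>u\<close>. For \<open>T\<close>, its inverse and \<open>id\<close>, condition
  \<open>c\<close> is the square-summability of the frame coefficients up to an index shift.\<close>

lemma adjoint_expansion:
  assumes dual: "dual_frame smul ip f g" and L: "bounded_op smul L"
    and c: "(\<lambda>k. (norm (ip y (L (f k))))\<^sup>2) summable_on UNIV"
  obtains u where "((\<lambda>k. smul (ip y (L (f k))) (g k)) has_sum u) UNIV" "\<And>x. ip (L x) y = ip x u"
proof -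
  have "(\<lambda>k. smul (ip y (L (f k))) (g k)) summable_on UNIV"
    using frame_synthesis_summable dual c by (auto simp: dual_frame_def)
  then obtain u where u: "((\<lambda>k. smul (ip y (L (f k))) (g k)) has_sum u) UNIV"
    by (auto simp: summable_on_def)
  have "ip (L x) y = ip x u" for x
  proof -
    have "((\<lambda>k. smul (ip x (g k)) (f k)) has_sum x) UNIV"
      using dual by (auto simp: dual_frame_def)
    then have "((\<lambda>k. ip (L (smul (ip x (g k)) (f k))) y) has_sum ip (L x) y) UNIV"
      by (intro has_sum_bounded_linear[OF bounded_linear_ip_left]
          has_sum_bounded_linear[OF bounded_op_bounded_linear[OF L]])
    moreover have "((\<lambda>k. ip x (smul (ip y (L (f k))) (g k))) has_sum ip x u) UNIV"
      by (rule has_sum_bounded_linear[OF bounded_linear_ip_right u])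
    moreover have "ip x (smul (ip y (L (f k))) (g k)) = ip (L (smul (ip x (g k)) (f k))) y" for k
      using L by (simp add: bounded_op_def linear_op_on_def ip_scale_left ip_scale_right
          ip_commute[of "L (f k)" y, symmetric] mult.commute)
    ultimately show ?thesis
      using has_sum_unique by fastforce
  qed
  with u show thesis
    using that by blast
qed

text \<open>The identity is its own adjoint, so \<open>adjoint_expansion\<close> with
  \<open>L = id\<close> exchanges the roles of \<open>f\<close> and \<open>g\<close>.\<close>

lemma dual_frame_swap:
  assumes "frame ip f" "dual_frame smul ip f g"
  shows "((\<lambda>k. smul (ip y (f k)) (g k)) has_sum y) UNIV"
proof -
  have "bounded_op smul id"
    by (auto simp: bounded_op_def linear_op_on_def bounded_op_on_def intro: exI[of _ 1])
  moreover have "(\<lambda>k. (norm (ip y (id (f k))))\<^sup>2) summable_on UNIV"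
    using assms(1) by (auto simp: frame_def)
  ultimately obtain u where
    u: "((\<lambda>k. smul (ip y (id (f k))) (g k)) has_sum u) UNIV" "\<And>x. ip (id x) y = ip x u"
    using adjoint_expansion[OF assms(2), of id y] by blast
  have "u = y"
    by (rule ip_eqI) (use u(2) in simp)
  with u(1) show ?thesis by simp
qed

lemma closure_span_eq_UNIV:
  assumes "\<And>y. \<exists>c. ((\<lambda>k. smul (c k) (g k)) has_sum y) UNIV"
  shows "closure (span (range g)) = UNIV"
proof -
  have "y \<in> closure (span (range g))" for y
  proof -
    obtain c where "((\<lambda>k. smul (c k) (g k)) has_sum y) UNIV"
      using assms by blast
    then have lim: "((\<lambda>F. \<Sum>k\<in>F. smul (c k) (g k)) \<longlongrightarrow> y) (finite_subsets_at_top UNIV)"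
      by (simp add: has_sum_def)
    have "(\<Sum>k\<in>F. smul (c k) (g k)) \<in> closure (span (range g))" for F
      by (intro subsetD[OF closure_subset] span_sum span_scale span_base) auto
    then show ?thesis
      by (intro Lim_in_closed_set[OF closed_closure _ _ lim]) auto
  qed
  then show ?thesis by blast
qed

text \<open>The set where two continuous maps agree is closed, so agreement on the dense set
  \<open>S\<close> forces equality and settles the definite description.\<close>

lemma bounded_extension_eqI:
  assumes "closure S = UNIV" "bounded_op smul W" "\<And>x. x \<in> S \<Longrightarrow> W x = V x"
  shows "bounded_extension smul S V = W"
  unfolding bounded_extension_def
proof (rule the_equality)
  show "bounded_op smul W \<and> (\<forall>x\<in>S. W x = V x)"
    using assms by blast
  fix U
  assume U: "bounded_op smul U \<and> (\<forall>x\<in>S. U x = V x)"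
  have cont: "continuous_on UNIV U" "continuous_on UNIV W"
    using U assms(2) bounded_op_bounded_linear linear_continuous_on by blast+
  have "closed {x. U x = W x}"
    using cont by (intro closed_Collect_eq)
  moreover have "S \<subseteq> {x. U x = W x}"
    using U assms(3) by auto
  ultimately have "closure S \<subseteq> {x. U x = W x}"
    by (rule closure_minimal[rotated])
  then show "U = W"
    using assms(1) by auto
qed

end

section \<open>Identification of the extension of \<open>V\<close>\<close>

theorem lemma3p4:
  fixes smul :: "'k::inner_scalar \<Rightarrow> 'a::banach \<Rightarrow> 'a"
    and ip :: "'a \<Rightarrow> 'a \<Rightarrow> 'k"
    and f g :: "int \<Rightarrow> 'a"
    and T V :: "'a \<Rightarrow> 'a"
  assumes "hilbert_space smul ip"
    and "frame ip f"
    and "invertible_op smul T"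
    and "\<forall>k. f k = int_power_on UNIV T k (f 0)"
    and "dual_frame smul ip f g"
    and "represents smul V g"
    and "bounded_op_on (module.span smul (range g)) V"
  shows "bounded_extension smul (module.span smul (range g)) V = inv (hilbert_adjoint ip T)"
proof -
  interpret hilbert_space smul ip by fact
  let ?S = "span (range g)"
  obtain R where T: "bounded_op smul T" and R: "bounded_op smul R" "T \<circ> R = id" "R \<circ> T = id"
    using assms(3) by (auto simp: invertible_op_def)
  have TR: "T (R x) = x" and RT: "R (T x) = x" for x
    using R(2,3) by (simp_all add: fun_eq_iff)
  note V = assms(6)[unfolded represents_def Let_def]
  note V = V[THEN conjunct1] V[THEN conjunct2, THEN conjunct1] V[THEN conjunct2, THEN conjunct2]
  have "bij T"
    by (rule o_bij[OF R(3,2)])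
  have Tf: "T (f k) = f (k + 1)" for k
    by (rule int_power_on_orbit[OF \<open>bij T\<close> UNIV_I assms(4)])
  have Vg: "V (g k) = g (k + 1)" for k
    by (rule int_power_on_orbit[OF V(2) span_base[OF rangeI] V(3)])
  have Rf: "R (f k) = f (k - 1)" for k
    using RT[of "f (k - 1)"] Tf[of "k - 1"] by simp
  have bessel: "(\<lambda>k. (norm (ip y (f k)))\<^sup>2) summable_on UNIV" for y
    using assms(2) by (auto simp: frame_def)
  have shift: "bij_betw (\<lambda>k. k + j) UNIV (UNIV :: int set)" for j
    by (rule bij_betwI[where g = "\<lambda>k. k - j"]) auto
  \<comment> \<open>\<open>T\<close> only shifts the frame, so these are the coefficients of
    \<open>y\<close> reindexed by a bijection of the integers.\<close>
  have "(\<lambda>k. (norm (ip y (T (f k))))\<^sup>2) summable_on UNIV" for y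
    unfolding Tf
    using summable_on_reindex_bij_betw[OF shift[of 1], THEN iffD2, OF bessel[of y]] .
  then have "\<exists>u. \<forall>x. ip (T x) y = ip x u" for y
    by (rule adjoint_expansion[OF assms(5) T]) blast
  then obtain M where M: "\<And>x y. ip (T x) y = ip x (M y)"
    by metis
  have "(\<lambda>k. (norm (ip y (R (f k))))\<^sup>2) summable_on UNIV" for y
    using summable_on_reindex_bij_betw[OF shift[of "-1"], THEN iffD2, OF bessel[of y]]
    by (simp only: Rf diff_conv_add_uminus)
  then have "\<exists>u. ((\<lambda>k. smul (ip y (f (k - 1))) (g k)) has_sum u) UNIV \<and>
      (\<forall>x. ip (R x) y = ip x u)" for y
    by (rule adjoint_expansion[OF assms(5) R(1)]) (auto simp only: Rf)
  then obtain N where N: "\<And>y. ((\<lambda>k. smul (ip y (f (k - 1))) (g k)) has_sum N y) UNIV"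
      "\<And>x y. ip (R x) y = ip x (N y)"
    by metis
  \<comment> \<open>Adjoints reverse products: <x, M (N y)> = <R (T x), y> = <x, y>, and
    symmetrically. Hence \<open>inv M\<close> is a genuine two-sided inverse.\<close>
  have "M (N y) = y" "N (M y) = y" for y
    by (rule ip_eqI, simp add: M[symmetric] N(2)[symmetric] TR RT)+
  then have "inv M = N"
    by (intro inv_equality) auto
  moreover have "hilbert_adjoint ip T = M"
    by (rule hilbert_adjoint_eqI) (rule M)
  moreover have "bounded_extension smul ?S V = N"
  proof (rule bounded_extension_eqI)
    show "closure ?S = UNIV"
      by (rule closure_span_eq_UNIV, rule exI, rule dual_frame_swap[OF assms(2,5)])
    show "bounded_op smul N"
      by (rule adjoint_bounded_op[OF R(1) N(2)])
    fix y
    assume y: "y \<in> ?S"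
    \<comment> \<open>Although \<open>y\<close> is a finite combination of the \<open>g k\<close>,
      the possibly infinite expansion with coefficients <y, f_k> is used, because \<open>N y\<close>
      is given by the same coefficients.\<close>
    have "((\<lambda>k. V (smul (ip y (f k)) (g k))) has_sum V y) UNIV"
      by (rule has_sum_bounded_op_on[OF V(1) assms(7)])
        (simp_all add: span_add span_diff span_scale span_base span_zero y
          dual_frame_swap[OF assms(2,5)])
    also have "(\<lambda>k. V (smul (ip y (f k)) (g k))) = (\<lambda>k. smul (ip y (f k)) (g (k + 1)))"
      using V(1) by (auto simp: linear_op_on_def Vg span_base)
    finally have "((\<lambda>k. smul (ip y (f k)) (g (k + 1))) has_sum V y) UNIV" .
    \<comment> \<open>Substituting \<open>k + 1\<close> for \<open>k\<close> moves the shift from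
      \<open>f\<close> to \<open>g\<close>, so both series coincide and uniqueness of sums
      applies.\<close>
    moreover have "((\<lambda>k. smul (ip y (f k)) (g (k + 1))) has_sum N y) UNIV"
      using N(1)[of y] has_sum_reindex_bij_betw[OF shift[of 1],
          of "\<lambda>k. smul (ip y (f (k - 1))) (g k)"] by simp
    ultimately show "N y = V y"
      by (metis has_sum_unique)
  qed
  ultimately show ?thesis
    by simp
qed

end
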